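(* Let $\mathbb{H}$ be an infinite-dimensional separable real Hilbert space and let $A$ be a positive bounded linear operator on $\mathbb{H}$. Suppose $B_{\mathbb{H}(A)}\cap\overline{R(A)}$ is bounded with respect to $\|\cdot\|$. Let $\epsilon\in[0,1)$ and let $T\in B_{A^{1/2}}(\mathbb{H})$ be a compact operator. Then $T$ is $(\epsilon,A)$-approximate left symmetric in the sense of Chmieliński if and only if $\|T\|_A=0$.
   Context: $\|\cdot\|$ is the Hilbert space norm of $\mathbb{H}$; compactness is with respect to it. A bounded linear operator $A$ on $\mathbb{H}$ is positive if $A=A^*$ and $\langle Ax,x\rangle\ge0$ for all $x$; $R(A)$ is its range and the closure $\overline{R(A)}$ is in $\|\cdot\|$. Put $\langle x,y\rangle_A=\langle Ax,y\rangle$, $\|x\|_A=\sqrt{\langle Ax,x\rangle}$, $B_{\mathbb{H}(A)}=\{x\in\mathbb{H}:\|x\|_A\le1\}$. $B_{A^{1/2}}(\mathbb{H})$ is the set of $A$-bounded operators, i.e. bounded linear operators $T$ on $\mathbb{H}$ for which there is $c>0$ with $\|Tx\|_A\le c\|x\|_A$ for all $x\in\mathbb{H}$; for such $T$, $\|T\|_A=\sup\{\|Tx\|_A:\|x\|_A=1\}$. For $T,S\in B_{A^{1/2}}(\mathbb{H})$, $T\bot_{\epsilon(A)}S$ means $\|T+\lambda S\|_A^2\ge\|T\|_A^2-2\epsilon\|T\|_A\|\lambda S\|_A$ for all scalars $\lambda$. $T\in B_{A^{1/2}}(\mathbb{H})$ is $(\epsilon,A)$-approximate left symmetric in the sense of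 Chmieliński if for every $S\in B_{A^{1/2}}(\mathbb{H})$, $T\bot_{\epsilon(A)}S$ implies $S\bot_{\epsilon(A)}T$.
   Formalization: The claim fails when A has rank one (for A = T the orthogonal projection onto a line, T is left symmetric although ‖T‖_A = 1), so the formal theorem additionally assumes that the range R(A) is not one-dimensional. *)

theory Defs
  imports "HOL-Analysis.Analysis"
begin

text \<open>
  The operator \<open>A\<close> is self-adjoint in the sense \<open>A = A\<^sup>*\<close>, with \<open>A\<^sup>*\<close> unfolded to its
  defining property; the library constant \<^const>\<open>adjoint\<close> chooses a map with this property.
\<close>

definition positive_operator :: "('a::real_inner \<Rightarrow>\<^sub>L 'a) \<Rightarrow> bool" where
  "positive_operator A \<longleftrightarrow> (\<forall>x y. A x \<bullet> y = x \<bullet> A y) \<and> (\<forall>x. 0 \<le> A x \<bullet> x)"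

definition compact_operator :: "('a::real_normed_vector \<Rightarrow>\<^sub>L 'b::real_normed_vector) \<Rightarrow> bool" where
  "compact_operator T \<longleftrightarrow> compact (closure (blinfun_apply T ` cball 0 1))"

definition A_inner :: "('a::real_inner \<Rightarrow>\<^sub>L 'a) \<Rightarrow> 'a \<Rightarrow> 'a \<Rightarrow> real" where
  "A_inner A x y = A x \<bullet> y"

definition A_norm :: "('a::real_inner \<Rightarrow>\<^sub>L 'a) \<Rightarrow> 'a \<Rightarrow> real" where
  "A_norm A x = sqrt (A_inner A x x)"

definition A_ball :: "('a::real_inner \<Rightarrow>\<^sub>L 'a) \<Rightarrow> 'a set" where
  "A_ball A = {x. A_norm A x \<le> 1}"

definition A_bounded :: "('a::real_inner \<Rightarrow>\<^sub>L 'a) \<Rightarrow> ('a \<Rightarrow>\<^sub>L 'a) \<Rightarrow> bool" where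
  "A_bounded A T \<longleftrightarrow> (\<exists>c>0. \<forall>x. A_norm A (T x) \<le> c * A_norm A x)"

text \<open>
  The supremum is taken in \<open>[0, \<infinity>)\<close>: inserting \<open>0\<close> changes nothing unless \<open>A = 0\<close>, when no
  vector has \<open>A\<close>-seminorm \<open>1\<close>; it then gives the supremum of the empty set the value \<open>0\<close>.
\<close>

definition A_opnorm :: "('a::real_inner \<Rightarrow>\<^sub>L 'a) \<Rightarrow> ('a \<Rightarrow>\<^sub>L 'a) \<Rightarrow> real" where
  "A_opnorm A T = Sup (insert 0 {A_norm A (T x) | x. A_norm A x = 1})"

definition approx_orthogonal ::
  "real \<Rightarrow> ('a::real_inner \<Rightarrow>\<^sub>L 'a) \<Rightarrow> ('a \<Rightarrow>\<^sub>L 'a) \<Rightarrow> ('a \<Rightarrow>\<^sub>L 'a) \<Rightarrow> bool" where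
  "approx_orthogonal \<epsilon> A T S \<longleftrightarrow>
     (\<forall>r::real. (A_opnorm A (T + r *\<^sub>R S))\<^sup>2 \<ge>
        (A_opnorm A T)\<^sup>2 - 2 * \<epsilon> * A_opnorm A T * A_opnorm A (r *\<^sub>R S))"

definition approx_left_symmetric ::
  "real \<Rightarrow> ('a::real_inner \<Rightarrow>\<^sub>L 'a) \<Rightarrow> ('a \<Rightarrow>\<^sub>L 'a) \<Rightarrow> bool" where
  "approx_left_symmetric \<epsilon> A T \<longleftrightarrow>
     A_bounded A T \<and>
     (\<forall>S. A_bounded A S \<longrightarrow> approx_orthogonal \<epsilon> A T S \<longrightarrow> approx_orthogonal \<epsilon> A S T)"

text \<open>
  Operators \<open>A\<close> of rank one have to be excluded from the characterization of approximate left
  symmetry: for the orthogonal projection \<open>A\<close> onto a line in any Hilbert space, \<open>T = A\<close> meets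
  all other hypotheses and is left symmetric, but has \<open>A\<close>-norm \<open>1\<close>.
\<close>

lemma rank_one_left_symmetric:
  fixes A :: "'a::real_inner \<Rightarrow>\<^sub>L 'a"
  assumes e: "norm e = 1" and A: "\<And>x. A x = (x \<bullet> e) *\<^sub>R e" and eps: "0 \<le> \<epsilon>" "\<epsilon> < 1"
  shows "positive_operator A"
    and "bounded (A_ball A \<inter> closure (range A))"
    and "A_bounded A A"
    and "compact_operator A"
    and "approx_left_symmetric \<epsilon> A A"
    and "A_opnorm A A = 1"
    and "dim (range A) = 1"
proof -
  have ee: "e \<bullet> e = 1" using e by (simp add: norm_eq_1)
  have nrm: "A_norm A x = \<bar>x \<bullet> e\<bar>" for x
    by (simp add: A_norm_def A_inner_def A inner_commute flip: power2_eq_square)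
  show "positive_operator A"
    by (auto simp: positive_operator_def A inner_commute)
  have rng: "range A = span {e}"
  proof -
    have "k *\<^sub>R e \<in> range A" for k
      by (rule range_eqI[of _ _ "k *\<^sub>R e"]) (simp add: A ee)
    then show ?thesis by (auto simp: span_singleton A)
  qed
  show "dim (range A) = 1"
  proof -
    have "independent {e}" using e by auto
    then show ?thesis unfolding rng using dim_span_eq_card_independent by fastforce
  qed
  have "closed {x. x = (x \<bullet> e) *\<^sub>R e}"
    by (intro closed_Collect_eq continuous_intros)
  then have "closure (range A) \<subseteq> {x. x = (x \<bullet> e) *\<^sub>R e}"
    by (intro closure_minimal) (auto simp: A ee)
  moreover have "norm x \<le> 1" if "x = (x \<bullet> e) *\<^sub>R e" "\<bar>x \<bullet> e\<bar> \<le> 1" for x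
  proof -
    have "norm x = \<bar>x \<bullet> e\<bar> * norm e" using that(1) by (metis norm_scaleR)
    then show ?thesis using that(2) e by simp
  qed
  ultimately show "bounded (A_ball A \<inter> closure (range A))"
    unfolding bounded_iff A_ball_def nrm by blast
  show AA: "A_bounded A A"
    unfolding A_bounded_def nrm by (rule exI[of _ 1]) (simp add: A ee)
  show "compact_operator A"
  proof -
    have "A ` cball 0 1 \<subseteq> (\<lambda>k. k *\<^sub>R e) ` {-1..1}"
    proof
      fix y assume "y \<in> A ` cball 0 1"
      then obtain x where x: "norm x \<le> 1" "y = A x" by auto
      have "\<bar>x \<bullet> e\<bar> \<le> 1" using Cauchy_Schwarz_ineq2[of x e] x e by simp
      then show "y \<in> (\<lambda>k. k *\<^sub>R e) ` {-1..1}" using x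
        by (auto simp: A abs_le_iff intro!: image_eqI[of _ _ "x \<bullet> e"])
    qed
    moreover have K: "compact ((\<lambda>k::real. k *\<^sub>R e) ` {-1..1})"
      by (intro compact_continuous_image continuous_intros compact_Icc)
    ultimately have "closure (A ` cball 0 1) \<subseteq> (\<lambda>k. k *\<^sub>R e) ` {-1..1}"
      by (intro closure_minimal compact_imp_closed)
    then show ?thesis
      using compact_Int_closed[OF K closed_closure[of "A ` cball 0 1"]]
      by (simp add: compact_operator_def Int_absorb1)
  qed
  have op: "A_opnorm A S = \<bar>S e \<bullet> e\<bar>" if S: "A_bounded A S" for S
  proof -
    obtain c where c: "\<And>x. \<bar>S x \<bullet> e\<bar> \<le> c * \<bar>x \<bullet> e\<bar>"
      using S by (auto simp: A_bounded_def nrm)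
    have *: "S x \<bullet> e = (x \<bullet> e) * (S e \<bullet> e)" for x
    proof -
      have "S (x - (x \<bullet> e) *\<^sub>R e) \<bullet> e = 0"
        using c[of "x - (x \<bullet> e) *\<^sub>R e"] by (simp add: inner_diff_left ee)
      then show ?thesis
        by (simp add: blinfun.diff_right blinfun.scaleR_right inner_diff_left)
    qed
    have "{A_norm A (S x) | x. A_norm A x = 1} = {\<bar>S e \<bullet> e\<bar>}"
    proof -
      have "\<bar>S x \<bullet> e\<bar> = \<bar>S e \<bullet> e\<bar>" if "\<bar>x \<bullet> e\<bar> = 1" for x
        using that by (simp add: *[of x] abs_mult)
      moreover have "\<bar>e \<bullet> e\<bar> = 1" by (simp add: ee)
      ultimately show ?thesis unfolding nrm by blast
    qed
    then show ?thesis by (simp add: A_opnorm_def cSup_eq_Max)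
  qed
  have comb: "A_bounded A (S + r *\<^sub>R R)" if SR: "A_bounded A S" "A_bounded A R" for S R and r :: real
  proof -
    obtain c d where c: "c > 0" "\<And>x. \<bar>S x \<bullet> e\<bar> \<le> c * \<bar>x \<bullet> e\<bar>"
      and d: "d > 0" "\<And>x. \<bar>R x \<bullet> e\<bar> \<le> d * \<bar>x \<bullet> e\<bar>"
      using SR unfolding A_bounded_def nrm by blast
    have "\<bar>(S + r *\<^sub>R R) x \<bullet> e\<bar> \<le> (c + \<bar>r\<bar> * d) * \<bar>x \<bullet> e\<bar>" for x
    proof -
      have "\<bar>(S + r *\<^sub>R R) x \<bullet> e\<bar> \<le> \<bar>S x \<bullet> e\<bar> + \<bar>r\<bar> * \<bar>R x \<bullet> e\<bar>"
        using abs_triangle_ineq[of "S x \<bullet> e" "r * (R x \<bullet> e)"]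
        by (simp add: blinfun.add_left blinfun.scaleR_left inner_add_left abs_mult)
      also have "\<dots> \<le> c * \<bar>x \<bullet> e\<bar> + \<bar>r\<bar> * (d * \<bar>x \<bullet> e\<bar>)"
        by (intro add_mono c mult_left_mono d) auto
      finally show ?thesis by (simp add: algebra_simps)
    qed
    moreover have "c + \<bar>r\<bar> * d > 0" using c d by (simp add: add_pos_nonneg)
    ultimately show ?thesis unfolding A_bounded_def nrm by blast
  qed
  have zero: "A_bounded A 0" unfolding A_bounded_def nrm by (rule exI[of _ 1]) simp
  have Ae: "A e \<bullet> e = 1" by (simp add: A ee)
  show "A_opnorm A A = 1" using op[OF AA] Ae by simp
  show "approx_left_symmetric \<epsilon> A A"
    unfolding approx_left_symmetric_def
  proof (intro conjI AA allI impI)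
    fix S assume S: "A_bounded A S" and orth: "approx_orthogonal \<epsilon> A A S"
    define s where "s = S e \<bullet> e"
    have "s = 0"
    proof (rule ccontr)
      assume "s \<noteq> 0"
      define l where "l = - (1 - \<epsilon>) / s"
      have ls: "l * s = - (1 - \<epsilon>)" using \<open>s \<noteq> 0\<close> by (simp add: l_def)
      have 1: "A_opnorm A (A + l *\<^sub>R S) = \<bar>1 + l * s\<bar>"
        using op[OF comb[OF AA S]] Ae
        by (simp add: blinfun.add_left blinfun.scaleR_left inner_add_left s_def)
      have 2: "A_opnorm A (l *\<^sub>R S) = \<bar>l * s\<bar>"
        using op[OF comb[OF zero S]]
        by (simp add: blinfun.scaleR_left s_def)
      have "\<epsilon>\<^sup>2 \<ge> 1 - 2 * \<epsilon> * (1 - \<epsilon>)"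
        using orth[unfolded approx_orthogonal_def, rule_format, of l] eps
        unfolding 1 2 op[OF AA] ls Ae by simp
      then have "0 \<ge> (1 - \<epsilon>)\<^sup>2" by (simp add: power2_eq_square algebra_simps)
      then show False using eps by simp
    qed
    then have "A_opnorm A S = 0" using op[OF S] by (simp add: s_def)
    then show "approx_orthogonal \<epsilon> A S A" by (simp add: approx_orthogonal_def)
  qed
qed

end

theory Submission
  imports Defs
begin

text \<open>
  On the closure of \<open>R(A)\<close> the seminorm of \<open>A\<close> dominates the Hilbert norm, and this closure
  together with the kernel of \<open>A\<close> spans the space; hence a compact \<open>T\<close> attains its \<open>A\<close>-norm \<open>t\<close> at
  some \<open>A\<close>-unit vector \<open>x0\<close>. Put \<open>z = T x0 / t\<close>. If \<open>t > 0\<close>, an operator \<open>S\<close> of rank two and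
  \<open>A\<close>-norm \<open>1\<close> with \<open>\<langle>S x0, z\<rangle>\<^sub>A = \<epsilon>\<close> satisfies \<open>T \<bottom> S\<close> by looking at \<open>x0\<close> alone. When \<open>S\<close>
  attains its norm only at a direction \<open>v\<close> with \<open>\<langle>S v, T v\<rangle>\<^sub>A > \<epsilon> t\<close>, subtracting a small multiple
  of \<open>T\<close> decreases the norm of \<open>S\<close> too fast for \<open>S \<bottom> T\<close>.
\<close>

section \<open>Closed convex sets in Hilbert space\<close>

text \<open>This replaces weak compactness of balls. Points \<open>z n\<close> of nearly minimal
  norm in \<open>C n\<close> are Cauchy by the parallelogram law, and completeness supplies a limit
  that lies in every \<open>C n\<close>.\<close>

lemma nested_closed_convex_Inter_nonempty:
  fixes C :: "nat \<Rightarrow> 'a::{real_inner, complete_space} set"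
  assumes closed: "\<And>n. closed (C n)" and convex: "\<And>n. convex (C n)"
    and decseq: "decseq C" and pts: "\<And>n. \<exists>x\<in>C n. norm x \<le> M"
  shows "(\<Inter>n. C n) \<noteq> {}"
proof -
  define d where "d n = (INF x\<in>C n. (norm x)\<^sup>2)" for n
  have ne: "C n \<noteq> {}" for n using pts by blast
  have bdd: "bdd_below ((\<lambda>x. (norm x)\<^sup>2) ` C n)" for n
    by (rule bdd_belowI2[of _ 0]) simp
  have d_le: "d n \<le> (norm x)\<^sup>2" if "x \<in> C n" for n x
    unfolding d_def by (rule cINF_lower[OF bdd that])
  have "incseq d"
    unfolding incseq_def d_def
    using decseq by (auto intro!: cINF_superset_mono ne bdd simp: decseq_def)
  moreover have "d n \<le> M\<^sup>2" for n
  proof -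
    obtain x where "x \<in> C n" "norm x \<le> M" using pts by blast
    then show ?thesis using d_le[of x n] power_mono[of "norm x" M 2] by simp
  qed
  ultimately obtain L where L: "d \<longlonglongrightarrow> L" "\<And>n. d n \<le> L"
    using incseq_convergent[of d "M\<^sup>2"] by blast
  define e where "e n = L - d n + 1 / real (Suc n)" for n
  have "\<exists>x\<in>C n. (norm x)\<^sup>2 < L + 1 / real (Suc n)" for n
  proof -
    have "d n < L + 1 / real (Suc n)"
      by (rule le_less_trans[OF L(2)]) simp
    then show ?thesis unfolding d_def using cINF_less_iff[OF ne bdd] by blast
  qed
  then obtain z where z: "\<And>n. z n \<in> C n" "\<And>n. (norm (z n))\<^sup>2 < L + 1 / real (Suc n)"
    by metis
  have "e \<longlonglongrightarrow> L - L + 0"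
    unfolding e_def by (intro tendsto_intros L LIMSEQ_Suc[OF lim_1_over_n])
  then have e0: "e \<longlonglongrightarrow> 0" by simp
  \<comment> \<open>The midpoint of \<open>z m\<close> and \<open>z n\<close> stays in the larger
    set \<open>C n\<close>, so its squared norm is at least \<open>d n\<close>; the parallelogram
    law turns this into a bound on the difference.\<close>
  have diff: "(norm (z m - z n))\<^sup>2 \<le> 4 * e n" if "n \<le> m" for m n
  proof -
    have zm: "z m \<in> C n" using z(1)[of m] decseq that by (auto simp: decseq_def)
    have "(1/2) *\<^sub>R z m + (1/2) *\<^sub>R z n \<in> C n"
      by (intro convexD[OF convex] zm z) auto
    from d_le[OF this] have "4 * d n \<le> (norm (z m + z n))\<^sup>2"
      by (simp flip: scaleR_add_right add: power_mult_distrib power_divide)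
    moreover have "(norm (z m - z n))\<^sup>2 = 2 * (norm (z m))\<^sup>2 + 2 * (norm (z n))\<^sup>2 - (norm (z m + z n))\<^sup>2"
      by (simp add: power2_norm_eq_inner algebra_simps inner_commute)
    moreover have "1 / real (Suc m) \<le> 1 / real (Suc n)"
      using that by (simp add: frac_le)
    ultimately show ?thesis using z(2)[of m] z(2)[of n] unfolding e_def by argo
  qed
  have "Cauchy z"
  proof (rule metric_CauchyI)
    fix r :: real assume "r > 0"
    then have "\<forall>\<^sub>F n in sequentially. e n < (r/2)\<^sup>2 / 4"
      by (intro order_tendstoD(2)[OF e0]) simp
    then obtain k where k: "e k < (r/2)\<^sup>2 / 4" by (auto simp: eventually_sequentially)
    have *: "dist (z m) (z k) < r/2" if "m \<ge> k" for m
    proof -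
      have "(norm (z m - z k))\<^sup>2 < (r/2)\<^sup>2" using diff[OF that] k by linarith
      then show ?thesis using \<open>r > 0\<close> power_less_imp_less_base[of "norm (z m - z k)" 2 "r/2"]
        by (simp add: dist_norm)
    qed
    then show "\<exists>k. \<forall>m\<ge>k. \<forall>n\<ge>k. dist (z m) (z n) < r"
      by (meson dist_triangle_half_l dist_commute)
  qed
  then obtain x where x: "z \<longlonglongrightarrow> x" using Cauchy_convergent_iff convergent_def by blast
  have "x \<in> C n" for n
  proof (rule closed_sequentially[OF closed])
    show "z (m + n) \<in> C n" for m
      using z(1)[of "m + n"] decseqD[OF decseq, of n "m + n"] by auto
    show "(\<lambda>m. z (m + n)) \<longlonglongrightarrow> x" using x by (rule LIMSEQ_ignore_initial_segment)
  qed
  then show ?thesis by blast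
qed

lemma subspace_closure:
  fixes S :: "'a::real_normed_vector set"
  assumes "subspace S"
  shows "subspace (closure S)"
  unfolding subspace_def
proof (intro conjI ballI allI)
  show "0 \<in> closure S" using assms closure_subset subspace_0 by blast
next
  fix x y assume "x \<in> closure S" "y \<in> closure S"
  then obtain f g where "\<And>n. f n \<in> S" "f \<longlonglongrightarrow> x" "\<And>n. g n \<in> S" "g \<longlonglongrightarrow> y"
    unfolding closure_sequential by blast
  then show "x + y \<in> closure S"
    unfolding closure_sequential
    by (intro exI[of _ "\<lambda>n. f n + g n"]) (simp add: assms subspace_add tendsto_add)
next
  fix c x assume "x \<in> closure S"
  then obtain f where "\<And>n. f n \<in> S" "f \<longlonglongrightarrow> x"
    unfolding closure_sequential by blast
  then show "c *\<^sub>R x \<in> closure S"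
    unfolding closure_sequential
    by (intro exI[of _ "\<lambda>n. c *\<^sub>R f n"]) (simp add: assms subspace_scale tendsto_intros)
qed

text \<open>A nearest point \<open>k\<close> of \<open>K\<close> to \<open>x\<close> lies in all
  sets of points of \<open>K\<close> at distance at most \<open>d + 1 / real (Suc n)\<close>, which
  are nested, closed and convex. Minimality along each line through \<open>k\<close> gives
  orthogonality.\<close>

lemma closed_subspace_orthogonal_decomposition:
  fixes K :: "'a::{real_inner, complete_space} set"
  assumes "subspace K" "closed K"
  obtains k where "k \<in> K" "\<And>y. y \<in> K \<Longrightarrow> (x - k) \<bullet> y = 0"
proof -
  define d where "d = (INF k\<in>K. norm (x - k))"
  have ne: "K \<noteq> {}" using assms subspace_0 by blast
  have bdd: "bdd_below ((\<lambda>k. norm (x - k)) ` K)" by (rule bdd_belowI2[of _ 0]) simp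
  have d_le: "d \<le> norm (x - k)" if "k \<in> K" for k
    unfolding d_def by (rule cINF_lower[OF bdd that])
  define C where "C n = K \<inter> cball x (d + 1 / real (Suc n))" for n
  have "(\<Inter>n. C n) \<noteq> {}"
  proof (rule nested_closed_convex_Inter_nonempty)
    show "closed (C n)" "convex (C n)" for n
      unfolding C_def using assms by (auto intro: closed_Int convex_Int subspace_imp_convex)
    show "decseq C"
      unfolding C_def decseq_def
      by (intro allI impI Int_mono order_refl subset_cball add_mono frac_le) auto
    show "\<exists>y\<in>C n. norm y \<le> norm x + d + 1" for n
    proof -
      have "d < d + 1 / real (Suc n)" by simp
      then obtain k where k: "k \<in> K" "norm (x - k) < d + 1 / real (Suc n)"
        unfolding d_def using cINF_less_iff[OF ne bdd] by blast
      have "1 / real (Suc n) \<le> 1" by simp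
      with k(2) have "norm (x - k) \<le> d + 1" by linarith
      then have "norm k \<le> norm x + d + 1"
        using norm_triangle_ineq4[of x "x - k"] by simp
      with k show ?thesis unfolding C_def by (auto simp: dist_norm intro!: bexI[of _ k])
    qed
  qed
  then obtain k where k: "\<And>n. k \<in> C n" by auto
  have kK: "k \<in> K" using k by (auto simp: C_def)
  have "norm (x - k) \<le> d"
  proof (rule LIMSEQ_le_const)
    have "(\<lambda>n. d + 1 / real (Suc n)) \<longlonglongrightarrow> d + 0"
      by (intro tendsto_intros LIMSEQ_Suc[OF lim_1_over_n])
    then show "(\<lambda>n. d + 1 / real (Suc n)) \<longlonglongrightarrow> d" by simp
    show "\<exists>N. \<forall>n\<ge>N. norm (x - k) \<le> d + 1 / real (Suc n)"
      using k by (simp add: C_def dist_norm)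
  qed
  then have min: "norm (x - k) \<le> norm (x - k')" if "k' \<in> K" for k'
    using d_le[OF that] by linarith
  have "(x - k) \<bullet> y = 0" if y: "y \<in> K" for y
  proof (cases "y = 0")
    case False
    \<comment> \<open>This coefficient minimizes the norm of
      \<open>(x - k) - s *\<^sub>R y\<close>.\<close>
    define s where "s = ((x - k) \<bullet> y) / (y \<bullet> y)"
    have "k + s *\<^sub>R y \<in> K" using assms kK y by (simp add: subspace_add subspace_scale)
    from min[OF this] have "(norm (x - k))\<^sup>2 \<le> (norm ((x - k) - s *\<^sub>R y))\<^sup>2"
      by (simp add: diff_diff_eq)
    also have "\<dots> = (norm (x - k))\<^sup>2 - 2 * s * ((x - k) \<bullet> y) + s * (s * (y \<bullet> y))"
      unfolding power2_norm_eq_inner inner_diff_left[of "x - k" "s *\<^sub>R y"] inner_diff_right[of _ "x - k" "s *\<^sub>R y"]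
      by (simp add: inner_commute[of y "x - k"] algebra_simps del: inner_diff_left inner_diff_right)
    also have "s * (y \<bullet> y) = (x - k) \<bullet> y" using False by (simp add: s_def)
    finally have "s * ((x - k) \<bullet> y) \<le> 0" by simp
    then have "((x - k) \<bullet> y)\<^sup>2 / (y \<bullet> y) \<le> 0" by (simp add: s_def power2_eq_square)
    then show ?thesis using False
      by (metis divide_le_0_iff inner_gt_zero_iff leD power2_less_eq_zero_iff)
  qed simp
  with kK that show ?thesis by blast
qed

section \<open>The semi-inner product of a positive operator\<close>

locale positive_op =
  fixes A :: "'a::real_inner \<Rightarrow>\<^sub>L 'a"
  assumes positive: "positive_operator A"
begin

abbreviation ip where "ip \<equiv> A_inner A"
abbreviation nm where "nm \<equiv> A_norm A"

lemma ip_commute: "ip x y = ip y x"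
  using positive by (metis A_inner_def inner_commute positive_operator_def)

lemma ip_linear [simp]:
  "ip (x + y) z = ip x z + ip y z" "ip z (x + y) = ip z x + ip z y"
  "ip (x - y) z = ip x z - ip y z" "ip z (x - y) = ip z x - ip z y"
  "ip (r *\<^sub>R x) z = r * ip x z" "ip z (r *\<^sub>R x) = r * ip z x"
  "ip (- x) z = - ip x z" "ip z (- x) = - ip z x"
  by (simp_all add: A_inner_def blinfun.bilinear_simps inner_simps)

lemma ip_nonneg: "0 \<le> ip x x"
  using positive unfolding A_inner_def positive_operator_def by blast

lemma nm_nonneg: "0 \<le> nm x"
  by (simp add: A_norm_def ip_nonneg)

lemma nm_sq: "(nm x)\<^sup>2 = ip x x"
  by (simp add: A_norm_def ip_nonneg)

lemma nm_scale: "nm (r *\<^sub>R x) = \<bar>r\<bar> * nm x"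
  by (simp add: A_norm_def real_sqrt_mult flip: mult.assoc)

lemma nm_eq_1_iff: "nm x = 1 \<longleftrightarrow> ip x x = 1"
  by (simp add: A_norm_def)

lemma Cauchy_Schwarz_ip: "\<bar>ip x y\<bar> \<le> nm x * nm y"
proof -
  have "(ip x y)\<^sup>2 \<le> ip x x * ip y y"
  proof -
    have quad: "0 \<le> ip x x + s * (2 * ip x y) + s\<^sup>2 * ip y y" for s
      using ip_nonneg[of "x + s *\<^sub>R y"]
      by (simp add: ip_commute[of y x] power2_eq_square algebra_simps)
    show ?thesis
    proof (cases "ip y y = 0")
      case True
      have "ip x y = 0"
      proof (rule ccontr)
        assume "ip x y \<noteq> 0"
        then show False
          \<comment> \<open>For an \<open>A\<close>-null \<open>y\<close> the quadratic is affine in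
            \<open>s\<close>, and this value of \<open>s\<close> makes it -1.\<close>
          using quad[of "- (ip x x + 1) / (2 * ip x y)"] ip_nonneg[of x] True by simp
      qed
      with True show ?thesis by simp
    next
      case False
      then have "ip y y > 0" using ip_nonneg[of y] by simp
      then show ?thesis using quad[of "- ip x y / ip y y"]
        by (simp add: field_simps power2_eq_square)
    qed
  qed
  then have "\<bar>ip x y\<bar>\<^sup>2 \<le> (nm x * nm y)\<^sup>2" by (simp add: power_mult_distrib nm_sq)
  then show ?thesis by (rule power2_le_imp_le) (simp add: nm_nonneg)
qed

lemma nm_triangle: "nm (x + y) \<le> nm x + nm y"
proof (rule power2_le_imp_le)
  show "(nm (x + y))\<^sup>2 \<le> (nm x + nm y)\<^sup>2"
    using Cauchy_Schwarz_ip[of x y]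
    by (simp add: nm_sq power2_sum ip_commute[of y x])
qed (simp add: nm_nonneg)

text \<open>Cauchy-Schwarz is applied to \<open>x\<close> and \<open>A x\<close>, since
  \<open>ip x (A x)\<close> is the squared Hilbert norm of \<open>A x\<close>.\<close>

lemma nm_eq_0_imp:
  assumes "nm x = 0"
  shows "A x = 0"
proof -
  have "A x \<bullet> A x \<le> 0"
    using Cauchy_Schwarz_ip[of x "A x"] assms by (simp add: A_inner_def)
  from antisym[OF this inner_ge_zero] show ?thesis by simp
qed

lemma continuous_on_nm [continuous_intros]:
  "continuous_on S f \<Longrightarrow> continuous_on S (\<lambda>x. nm (f x))"
  unfolding A_norm_def A_inner_def by (intro continuous_intros)

lemma convex_nm_ball: "convex {x. nm x \<le> r}"
proof (rule convexI)
  fix x y and u v :: real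
  assume *: "x \<in> {x. nm x \<le> r}" "y \<in> {x. nm x \<le> r}" "0 \<le> u" "0 \<le> v" "u + v = 1"
  have "nm (u *\<^sub>R x + v *\<^sub>R y) \<le> u * nm x + v * nm y"
    using nm_triangle[of "u *\<^sub>R x" "v *\<^sub>R y"] * by (simp add: nm_scale)
  also have "\<dots> \<le> u * r + v * r" using * by (intro add_mono mult_left_mono) auto
  finally show "u *\<^sub>R x + v *\<^sub>R y \<in> {x. nm x \<le> r}" using * by (simp flip: distrib_right)
qed

text \<open>If every vector \<open>A\<close>-orthogonal to \<open>e\<close> were
  \<open>A\<close>-null, then \<open>A\<close> would vanish on all of them, and its range would be
  the line through \<open>A e\<close>.\<close>

lemma exists_unit_orthogonal:
  assumes rank: "dim (range A) \<noteq> 1" and e: "nm e = 1"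
  obtains y where "nm y = 1" "ip e y = 0"
proof -
  have "\<exists>u. ip e u = 0 \<and> nm u \<noteq> 0"
  proof (rule ccontr)
    assume "\<not> ?thesis"
    then have ker: "A u = 0" if "ip e u = 0" for u using that nm_eq_0_imp by blast
    have Ax: "A x = ip e x *\<^sub>R A e" for x
    proof -
      have "A (x - ip e x *\<^sub>R e) = 0" using e by (intro ker) (simp add: nm_eq_1_iff)
      then show ?thesis by (simp add: blinfun.bilinear_simps)
    qed
    have "k *\<^sub>R A e \<in> range A" for k
      by (rule range_eqI[of _ _ "k *\<^sub>R e"]) (simp add: blinfun.bilinear_simps)
    moreover have "A x \<in> span {A e}" for x
      unfolding Ax[of x] by (intro span_scale span_base) simp
    ultimately have rng: "range A = span {A e}" unfolding span_singleton by blast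
    have "A e \<noteq> 0" using e by (auto simp: nm_eq_1_iff A_inner_def)
    then have "independent {A e}" by auto
    then have "dim (range A) = 1"
      unfolding rng using dim_span_eq_card_independent by fastforce
    with rank show False by simp
  qed
  then obtain u where "ip e u = 0" "nm u \<noteq> 0" by blast
  then show ?thesis using that[of "(1 / nm u) *\<^sub>R u"] nm_nonneg[of u] by (simp add: nm_scale)
qed

section \<open>The operator seminorm\<close>

lemma bdd_above_A_opnorm:
  assumes "A_bounded A S"
  shows "bdd_above (insert 0 {nm (S x) | x. nm x = 1})"
proof -
  obtain c where "\<And>x. nm (S x) \<le> c * nm x" using assms by (auto simp: A_bounded_def)
  from this have "\<And>x. nm x = 1 \<Longrightarrow> nm (S x) \<le> c" by (metis mult.right_neutral)
  then have "bdd_above {nm (S x) | x. nm x = 1}" by (auto intro: bdd_aboveI[of _ c])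
  then show ?thesis by simp
qed

lemma nm_le_A_opnorm: "A_bounded A S \<Longrightarrow> nm x = 1 \<Longrightarrow> nm (S x) \<le> A_opnorm A S"
  unfolding A_opnorm_def by (rule cSup_upper) (auto dest: bdd_above_A_opnorm)

lemma A_opnorm_nonneg: "A_bounded A S \<Longrightarrow> 0 \<le> A_opnorm A S"
  unfolding A_opnorm_def by (rule cSup_upper) (auto dest: bdd_above_A_opnorm)

lemma A_opnorm_least:
  fixes S :: "'a \<Rightarrow>\<^sub>L 'a"
  shows "0 \<le> m \<Longrightarrow> (\<And>x. nm x = 1 \<Longrightarrow> nm (S x) \<le> m) \<Longrightarrow> A_opnorm A S \<le> m"
  unfolding A_opnorm_def by (rule cSup_least) auto

lemma nm_le_A_opnorm_mult:
  assumes "A_bounded A S"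
  shows "nm (S x) \<le> A_opnorm A S * nm x"
proof (cases "nm x = 0")
  \<comment> \<open>Normalizing is impossible here, but \<open>A\<close>-boundedness sends
    \<open>A\<close>-null vectors to \<open>A\<close>-null vectors.\<close>
  case True
  obtain c where "\<And>x. nm (S x) \<le> c * nm x" using assms by (auto simp: A_bounded_def)
  from this[of x] show ?thesis using True by simp
next
  case False
  then have pos: "nm x > 0" using nm_nonneg[of x] by simp
  have "nm (S ((1 / nm x) *\<^sub>R x)) \<le> A_opnorm A S"
    using pos by (intro nm_le_A_opnorm assms) (simp add: nm_scale)
  then show ?thesis using pos by (simp add: blinfun.scaleR_right nm_scale field_simps)
qed

lemma A_bounded_add_scaleR:
  assumes S: "A_bounded A S" and R: "A_bounded A R"
  shows "A_bounded A (S + r *\<^sub>R R)"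
proof -
  have "nm ((S + r *\<^sub>R R) x) \<le> (A_opnorm A S + \<bar>r\<bar> * A_opnorm A R + 1) * nm x" for x
    using nm_triangle[of "S x" "r *\<^sub>R R x"] nm_le_A_opnorm_mult[OF S, of x] nm_nonneg[of x]
      mult_left_mono[OF nm_le_A_opnorm_mult[OF R, of x], of "\<bar>r\<bar>"]
    by (simp add: blinfun.bilinear_simps nm_scale algebra_simps)
  moreover have "A_opnorm A S + \<bar>r\<bar> * A_opnorm A R + 1 > 0"
    using A_opnorm_nonneg[OF S] A_opnorm_nonneg[OF R] by (simp add: add_nonneg_pos)
  ultimately show ?thesis unfolding A_bounded_def by blast
qed

lemma A_bounded_zero: "A_bounded A 0"
  using nm_scale[of 0 0] unfolding A_bounded_def by (intro exI[of _ 1]) (simp add: nm_nonneg)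

lemma A_bounded_scaleR: "A_bounded A S \<Longrightarrow> A_bounded A (r *\<^sub>R S)"
  using A_bounded_add_scaleR[OF A_bounded_zero, of S r] by simp

lemma A_opnorm_add_null:
  assumes T: "A_bounded A T" "A_opnorm A T = 0"
  shows "A_opnorm A (S + r *\<^sub>R T) = A_opnorm A S"
proof -
  have null: "nm (s *\<^sub>R T x) = 0" for s x
    using nm_le_A_opnorm_mult[OF T(1), of x] nm_nonneg[of "T x"] T(2) by (simp add: nm_scale)
  have "nm ((S + r *\<^sub>R T) x) = nm (S x)" for x
    using nm_triangle[of "S x" "r *\<^sub>R T x"] nm_triangle[of "S x + r *\<^sub>R T x" "(- r) *\<^sub>R T x"]
      null[of r x] null[of "- r" x]
    by (simp add: blinfun.bilinear_simps)
  then show ?thesis by (simp add: A_opnorm_def)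
qed

text \<open>A norming vector behaves like a top singular vector.\<close>

lemma norming_vector_orthogonal:
  assumes T: "A_bounded A T" and x: "nm x = 1" "nm (T x) = A_opnorm A T" and y: "ip x y = 0"
  shows "ip (T x) (T y) = 0"
proof (rule ccontr)
  define t where "t = A_opnorm A T"
  define p where "p = ip (T x) (T y)"
  assume "ip (T x) (T y) \<noteq> 0"
  then have p: "p \<noteq> 0" by (simp add: p_def)
  \<comment> \<open>Comparing both sides of the norm bound at \<open>x + s *\<^sub>R y\<close>, the
    constant terms cancel because \<open>x\<close> is norming. A linear term in \<open>s\<close> is
    left below a quadratic one, which is impossible for small \<open>s\<close> of the sign of
    \<open>p\<close>.\<close>
  have *: "2 * s * p \<le> s\<^sup>2 * (t\<^sup>2 * ip y y)" for s
  proof -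
    have "(nm (T (x + s *\<^sub>R y)))\<^sup>2 \<le> (t * nm (x + s *\<^sub>R y))\<^sup>2"
      unfolding t_def by (intro power_mono nm_le_A_opnorm_mult T nm_nonneg)
    moreover have "(nm (T (x + s *\<^sub>R y)))\<^sup>2 = t\<^sup>2 + 2 * s * p + s\<^sup>2 * ip (T y) (T y)"
      using nm_sq[of "T x"] unfolding nm_sq[of "T (x + s *\<^sub>R y)"] x(2)
      by (simp add: t_def p_def blinfun.bilinear_simps ip_commute[of "T y" "T x"]
          power2_eq_square algebra_simps)
    moreover have "(nm (x + s *\<^sub>R y))\<^sup>2 = 1 + s\<^sup>2 * ip y y"
      using x(1) y unfolding nm_sq by (simp add: nm_eq_1_iff ip_commute[of y x] power2_eq_square)
    moreover have "0 \<le> s\<^sup>2 * ip (T y) (T y)" by (simp add: ip_nonneg)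
    ultimately show ?thesis by (simp add: power_mult_distrib algebra_simps)
  qed
  \<comment> \<open>The added 1 keeps \<open>B\<close> positive, so \<open>s = p / B\<close> is a
    legitimate choice.\<close>
  define B where "B = t\<^sup>2 * ip y y + 1"
  have B: "B > 0" unfolding B_def by (simp add: ip_nonneg add_nonneg_pos)
  have "2 * (p / B) * p \<le> (p / B)\<^sup>2 * B"
    using *[of "p / B"] mult_left_mono[of "t\<^sup>2 * ip y y" B "(p / B)\<^sup>2"] unfolding B_def by simp
  then have "p\<^sup>2 / B \<le> 0" using B by (simp add: power2_eq_square field_simps)
  then show False using B p by (simp add: divide_le_0_iff)
qed

end

section \<open>Norm attainment of compact operators\<close>

text \<open>A maximizing sequence can be moved into the closure of the range without changing its
  seminorms, and is bounded in norm there. Compactness makes a subsequence of the images converge; a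
  common point of nested convex sets then plays the role of a weak limit of the vectors
  themselves.\<close>

lemma compact_operator_attains_A_opnorm:
  fixes A T :: "'a::{real_inner, complete_space} \<Rightarrow>\<^sub>L 'a"
  assumes positive: "positive_operator A"
    and bounded: "bounded (A_ball A \<inter> closure (range A))"
    and T: "A_bounded A T" and compact: "compact_operator T" and t: "A_opnorm A T > 0"
  obtains x where "A_norm A x = 1" "A_norm A (T x) = A_opnorm A T"
proof -
  interpret positive_op A by unfold_locales (rule positive)
  define K where "K = closure (range A)"
  define t where "t = A_opnorm A T"
  obtain M where M: "M > 0" "\<And>x. x \<in> K \<Longrightarrow> nm x \<le> 1 \<Longrightarrow> norm x \<le> M"
    using bounded unfolding bounded_pos K_def A_ball_def by auto
  have "subspace K"
    unfolding K_def
    by (intro subspace_closure linear_subspace_image subspace_UNIV)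
       (simp add: blinfun.bounded_linear_right bounded_linear.linear)
  \<comment> \<open>Since \<open>A\<close> is self-adjoint, a vector orthogonal to its range lies in
    its kernel.\<close>
  have proj: "\<exists>k\<in>K. A (x - k) = 0" for x
  proof -
    obtain k where k: "k \<in> K" "\<And>y. y \<in> K \<Longrightarrow> (x - k) \<bullet> y = 0"
      using closed_subspace_orthogonal_decomposition[OF \<open>subspace K\<close>] K_def by blast
    have "A (x - k) \<bullet> A (x - k) = (x - k) \<bullet> A (A (x - k))"
      using positive by (simp add: positive_operator_def)
    also have "\<dots> = 0" unfolding K_def
      by (intro k(2)[unfolded K_def] closure_subset[THEN subsetD] rangeI)
    finally show ?thesis using k(1) by auto
  qed
  have "\<exists>k. nm k = 1 \<and> norm k \<le> M \<and> nm (T k) > t - 1 / real (Suc n)" for n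
  proof -
    have "\<exists>x. nm x = 1 \<and> nm (T x) > t - 1 / real (Suc n)"
    proof (rule ccontr)
      assume "\<not> ?thesis"
      \<comment> \<open>The maximum with 0 accounts for the 0 inserted in the supremum;
        \<open>t\<close> exceeds both alternatives.\<close>
      then have "t \<le> max 0 (t - 1 / real (Suc n))"
        unfolding t_def by (intro A_opnorm_least) (auto simp: not_less le_max_iff_disj)
      then show False using t by (simp add: t_def max_def split: if_splits)
    qed
    then obtain x where x: "nm x = 1" "nm (T x) > t - 1 / real (Suc n)" by blast
    obtain k where k: "k \<in> K" "A (x - k) = 0" using proj by blast
    have null: "ip (x - k) u = 0" for u by (simp add: A_inner_def k(2))
    have "ip x x = ip k k" using null[of x] null[of k] by (simp add: ip_commute[of k x])
    then have "nm k = 1" using x(1) by (simp add: nm_eq_1_iff)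
    \<comment> \<open>The discarded component \<open>x - k\<close> is \<open>A\<close>-null, and so
      is its image under the \<open>A\<close>-bounded \<open>T\<close>.\<close>
    moreover have "nm (T x) \<le> nm (T k)"
    proof -
      have "nm (x - k) = 0" using null[of "x - k"] by (simp only: A_norm_def real_sqrt_zero)
      then have "nm (T (x - k)) \<le> 0" using nm_le_A_opnorm_mult[OF T, of "x - k"] by simp
      then show ?thesis using nm_triangle[of "T (x - k)" "T k"] by (simp add: blinfun.bilinear_simps)
    qed
    ultimately show ?thesis using M(2)[OF k(1)] x(2) by (intro exI[of _ k]) simp
  qed
  then obtain k where k: "\<And>n. nm (k n) = 1" "\<And>n. norm (k n) \<le> M"
      "\<And>n. nm (T (k n)) > t - 1 / real (Suc n)"
    by metis
  \<comment> \<open>Scaling by \<open>1 / M\<close> moves the sequence into the unit ball used by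
    \<open>compact_operator\<close>; the factor is restored in \<open>y\<close>.\<close>
  have "\<forall>n. T ((1 / M) *\<^sub>R k n) \<in> closure (T ` cball 0 1)"
    using k(2) M(1) by (intro allI closure_subset[THEN subsetD] imageI) simp
  then obtain l r where r: "strict_mono r" "((\<lambda>n. T ((1 / M) *\<^sub>R k n)) \<circ> r) \<longlonglongrightarrow> l"
    using compact[unfolded compact_operator_def compact_def, rule_format,
        of "\<lambda>n. T ((1 / M) *\<^sub>R k n)"] by blast
  define y where "y = M *\<^sub>R l"
  have "(\<lambda>n. M *\<^sub>R ((\<lambda>n. T ((1 / M) *\<^sub>R k n)) \<circ> r) n) \<longlonglongrightarrow> y"
    unfolding y_def by (intro tendsto_intros r)
  then have lim: "(\<lambda>n. T (k (r n))) \<longlonglongrightarrow> y"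
    using M(1) by (simp add: blinfun.scaleR_right)
  \<comment> \<open>A common point of these sets is a preimage of \<open>y\<close> with seminorm at
    most 1. Each set contains some \<open>k (r m)\<close>.\<close>
  define C where "C n = cball 0 M \<inter> {x. nm x \<le> 1} \<inter> T -` cball y (1 / real (Suc n))" for n
  have "(\<Inter>n. C n) \<noteq> {}"
  proof (rule nested_closed_convex_Inter_nonempty)
    show "closed (C n)" for n
      unfolding C_def
      by (intro closed_Int closed_cball closed_Collect_le continuous_intros closed_vimage)
    show "convex (C n)" for n
      unfolding C_def
      by (intro convex_Int convex_cball convex_nm_ball convex_linear_vimage)
         (simp add: blinfun.bounded_linear_right bounded_linear.linear)
    show "decseq C"
      unfolding C_def decseq_def
      by (intro allI impI Int_mono order_refl subset_cball vimage_mono frac_le) auto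
    show "\<exists>x\<in>C n. norm x \<le> M" for n
    proof -
      have "\<forall>\<^sub>F m in sequentially. dist (T (k (r m))) y < 1 / real (Suc n)"
        by (rule tendstoD[OF lim]) simp
      then obtain m where "dist (T (k (r m))) y < 1 / real (Suc n)"
        by (auto simp: eventually_sequentially)
      then have "k (r m) \<in> C n" using k(1,2) by (simp add: C_def dist_commute)
      with k(2) show ?thesis by blast
    qed
  qed
  then obtain x where x: "\<And>n. x \<in> C n" by blast
  have "dist y (T x) \<le> 0"
    by (rule LIMSEQ_le_const[OF LIMSEQ_Suc[OF lim_1_over_n]])
       (use x in \<open>simp add: C_def\<close>)
  then have Tx: "T x = y" by simp
  have "t - 0 \<le> nm y"
  proof (rule LIMSEQ_le)
    show "(\<lambda>n. t - 1 / real (Suc n)) \<longlonglongrightarrow> t - 0"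
      by (intro tendsto_intros LIMSEQ_Suc[OF lim_1_over_n])
    have "isCont nm y"
      using continuous_on_nm[OF continuous_on_id, of UNIV] by (simp add: continuous_on_eq_continuous_at)
    then show "(\<lambda>n. nm (T (k (r n)))) \<longlonglongrightarrow> nm y" by (rule isCont_tendsto_compose[OF _ lim])
    have "t - 1 / real (Suc n) \<le> nm (T (k (r n)))" for n
    proof -
      have "1 / real (Suc (r n)) \<le> 1 / real (Suc n)"
        using seq_suble[OF r(1), of n] by (simp add: frac_le)
      then show ?thesis using k(3)[of "r n"] by linarith
    qed
    then show "\<exists>N. \<forall>n\<ge>N. t - 1 / real (Suc n) \<le> nm (T (k (r n)))" by blast
  qed
  \<comment> \<open>The chain \<open>t \<le> nm (T x) \<le> t * nm x \<le> t\<close> forces equality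
    throughout, hence \<open>nm x = 1\<close>.\<close>
  then have 1: "t \<le> nm (T x)" by (simp add: Tx)
  have 2: "nm (T x) \<le> t * nm x" unfolding t_def by (rule nm_le_A_opnorm_mult[OF T])
  have 3: "nm x \<le> 1" using x by (simp add: C_def)
  have "t > 0" using t by (simp add: t_def)
  then have "nm x = 1" using 1 2 3 by (smt (verit) mult_less_cancel_left2)
  moreover have "nm (T x) = t" using 1 2 \<open>nm x = 1\<close> by simp
  ultimately show ?thesis using that t_def by blast
qed

section \<open>Failure of left symmetry\<close>

text \<open>The rank condition provides a second direction both at \<open>x0\<close> and at
  \<open>z\<close>. This leaves room for \<open>S\<close> to have correlation only \<epsilon> with
  \<open>T\<close> at \<open>x0\<close>, but a larger one at the vector \<open>v\<close> where
  \<open>S\<close> attains its norm.\<close>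

lemma (in positive_op) norming_vector_not_left_symmetric:
  assumes rank: "dim (range A) \<noteq> 1" and eps: "0 \<le> \<epsilon>" "\<epsilon> < 1"
    and T: "A_bounded A T" and pos: "A_opnorm A T > 0"
    and x0: "nm x0 = 1" "nm (T x0) = A_opnorm A T"
  shows "\<not> approx_left_symmetric \<epsilon> A T"
proof -
  define t where "t = A_opnorm A T"
  have t: "t > 0" using pos by (simp add: t_def)
  define z where "z = (1 / t) *\<^sub>R T x0"
  have Tx0: "T x0 = t *\<^sub>R z" using t by (simp add: z_def)
  have z: "nm z = 1" using x0(2) t by (simp add: z_def nm_scale t_def)
  obtain y where y: "nm y = 1" "ip x0 y = 0" using exists_unit_orthogonal[OF rank x0(1)] .
  \<comment> \<open>The sign of \<open>z'\<close> is chosen so that the term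
    \<open>(1 - c) * ip z' (T y)\<close> of \<open>ip v' (T v)\<close> cannot hurt.\<close>
  obtain z' where z': "nm z' = 1" "ip z z' = 0" "0 \<le> ip z' (T y)"
  proof -
    obtain u where u: "nm u = 1" "ip z u = 0" using exists_unit_orthogonal[OF rank z] .
    show ?thesis
    proof (cases "0 \<le> ip u (T y)")
      case True with u that show ?thesis by blast
    next
      case False with u that[of "- u"] show ?thesis by (simp add: nm_eq_1_iff)
    qed
  qed
  have zTy: "ip z (T y) = 0"
    using norming_vector_orthogonal[OF T x0 y(2)] by (simp add: z_def)
  have ips: "ip x0 x0 = 1" "ip y y = 1" "ip x0 y = 0" "ip y x0 = 0"
      "ip z z = 1" "ip z' z' = 1" "ip z z' = 0" "ip z' z = 0"
    using x0(1) y z z' by (simp_all add: nm_eq_1_iff ip_commute)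
  text \<open>
    \<open>S\<close> has singular values \<open>1\<close> and \<open>1/3\<close>, the second with a reversed sign; \<open>c\<close> is then the solution of
    \<open>\<langle>S x0, z\<rangle> = c - (1 - c) / 3 = \<epsilon>\<close>, and \<open>\<langle>S v, T v\<rangle> \<ge> c t\<close> with \<open>c > \<epsilon>\<close>.
  \<close>
  define c where "c = (1 + 3 * \<epsilon>) / 4"
  have c: "0 \<le> c" "c \<le> 1" using eps by (simp_all add: c_def)
  \<comment> \<open>As \<open>a\<close> and \<open>b\<close> have squares summing to 1, one
    orthogonal matrix carries \<open>x0\<close>, \<open>y\<close> to the
    \<open>A\<close>-orthonormal pair \<open>v\<close>, \<open>w\<close> and \<open>z\<close>,
    \<open>z'\<close> to \<open>v'\<close>, \<open>w'\<close>.\<close>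
  define a where "a = sqrt c"
  define b where "b = sqrt (1 - c)"
  have ab: "a * a = c" "b * b = 1 - c" using c by (simp_all add: a_def b_def)
  define v where "v = a *\<^sub>R x0 + b *\<^sub>R y"
  define w where "w = b *\<^sub>R x0 - a *\<^sub>R y"
  define v' where "v' = a *\<^sub>R z + b *\<^sub>R z'"
  define w' where "w' = b *\<^sub>R z - a *\<^sub>R z'"
  have vw: "ip v v = 1" "ip w w = 1" "ip v w = 0" "ip w v = 0"
    and vw': "ip v' v' = 1" "ip w' w' = 1" "ip v' w' = 0" "ip w' v' = 0"
    by (simp_all add: v_def w_def v'_def w'_def ips ab)
  define S where "S = Blinfun (\<lambda>x. ip x v *\<^sub>R v' - (ip x w / 3) *\<^sub>R w')"
  have "bounded_linear (\<lambda>x. ip x v *\<^sub>R v' - (ip x w / 3) *\<^sub>R w')"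
    unfolding A_inner_def
    by (intro bounded_linear_sub bounded_linear_compose[OF bounded_linear_scaleR_left]
        bounded_linear_compose[OF bounded_linear_divide]
        bounded_linear_compose[OF bounded_linear_inner_left] blinfun.bounded_linear_right)
  then have S: "S x = ip x v *\<^sub>R v' - (ip x w / 3) *\<^sub>R w'" for x
    unfolding S_def by (simp add: bounded_linear_Blinfun_apply)
  have Bessel: "(ip x v)\<^sup>2 + (ip x w)\<^sup>2 \<le> ip x x" for x
    using ip_nonneg[of "x - ip x v *\<^sub>R v - ip x w *\<^sub>R w"] vw
    by (simp add: ip_commute[of v x] ip_commute[of w x] power2_eq_square algebra_simps)
  have SS: "ip (S x) (S x) = (ip x v)\<^sup>2 + (ip x w)\<^sup>2 / 9" for x
    by (simp add: S vw' power2_eq_square)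
  have S_le: "nm (S x) \<le> nm x" for x
  proof (rule power2_le_imp_le)
    show "(nm (S x))\<^sup>2 \<le> (nm x)\<^sup>2"
      using Bessel[of x] zero_le_power2[of "ip x w"] by (simp only: nm_sq SS)
  qed (rule nm_nonneg)
  have SA: "A_bounded A S"
    unfolding A_bounded_def using S_le by (intro exI[of _ 1]) simp
  have Sv: "S v = v'" by (simp add: S vw)
  have nm_v: "nm v = 1" and nm_v': "nm v' = 1" and nm_w': "nm w' = 1"
    by (simp_all add: nm_eq_1_iff vw vw')
  have "A_opnorm A S \<le> 1" using S_le by (intro A_opnorm_least) (simp, metis)
  moreover have "1 \<le> A_opnorm A S" using nm_le_A_opnorm[OF SA nm_v] by (simp add: Sv nm_v')
  ultimately have S1: "A_opnorm A S = 1" by simp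
  \<comment> \<open>Evaluating at \<open>x0\<close> gives the cross term
    \<open>2 * r * t * \<epsilon>\<close>; its possible loss is covered because
    \<open>r *\<^sub>R S\<close> has \<open>A\<close>-norm at least the absolute value of
    \<open>r\<close>.\<close>
  have orth: "approx_orthogonal \<epsilon> A T S"
    unfolding approx_orthogonal_def
  proof
    fix r :: real
    have "ip (S x0) z = \<epsilon>"
      by (simp add: S v_def w_def v'_def w'_def ips ab) (simp add: c_def field_simps)
    then have zS: "ip (S x0) z = \<epsilon>" "ip z (S x0) = \<epsilon>" by (simp_all add: ip_commute)
    have "ip ((T + r *\<^sub>R S) x0) ((T + r *\<^sub>R S) x0)
        = t\<^sup>2 + 2 * r * t * \<epsilon> + r\<^sup>2 * ip (S x0) (S x0)"
      by (simp add: blinfun.bilinear_simps Tx0 zS ips power2_eq_square algebra_simps)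
    moreover have "0 \<le> r\<^sup>2 * ip (S x0) (S x0)" by (simp add: ip_nonneg)
    ultimately have "t\<^sup>2 + 2 * r * t * \<epsilon> \<le> (nm ((T + r *\<^sub>R S) x0))\<^sup>2"
      by (simp add: nm_sq)
    also have "\<dots> \<le> (A_opnorm A (T + r *\<^sub>R S))\<^sup>2"
      by (intro power_mono nm_le_A_opnorm A_bounded_add_scaleR T SA x0 nm_nonneg)
    finally have 1: "t\<^sup>2 + 2 * r * t * \<epsilon> \<le> (A_opnorm A (T + r *\<^sub>R S))\<^sup>2" .
    have "\<bar>r\<bar> \<le> A_opnorm A (r *\<^sub>R S)"
      using nm_le_A_opnorm[OF A_bounded_scaleR[OF SA] nm_v, of r]
      by (simp add: blinfun.bilinear_simps Sv nm_scale nm_v')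
    then have "- r \<le> A_opnorm A (r *\<^sub>R S)" by linarith
    then have "2 * \<epsilon> * t * (- r) \<le> 2 * \<epsilon> * t * A_opnorm A (r *\<^sub>R S)"
      using eps t by (intro mult_left_mono) auto
    then show "(A_opnorm A T)\<^sup>2 - 2 * \<epsilon> * A_opnorm A T * A_opnorm A (r *\<^sub>R S)
        \<le> (A_opnorm A (T + r *\<^sub>R S))\<^sup>2"
      using 1 unfolding t_def[symmetric] by (simp add: algebra_simps)
  qed
  \<comment> \<open>The perturbation is \<open>- h\<close> times the normalized \<open>T\<close>.
    This \<open>h\<close> makes \<open>11 / 3 * h\<close> smaller than
    \<open>2 * (c - \<epsilon>) = (1 - \<epsilon>) / 2\<close>, and \<open>h * c\<close> at most
    1/9.\<close>
  define h where "h = (1 - \<epsilon>) / 9"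
  have h: "0 < h" "h \<le> 1 / 9" using eps by (simp_all add: h_def)
  define m where "m = 1 - 2 * h * c + 11 / 3 * h\<^sup>2"
  have vTv: "c * t \<le> ip v' (T v)"
  proof -
    have "ip v' (T v) = a * a * t + b * b * ip z' (T y)"
      by (simp add: v'_def v_def blinfun.bilinear_simps Tx0 ips zTy algebra_simps)
    also have "\<dots> = c * t + (1 - c) * ip z' (T y)" by (simp only: ab)
    finally have "ip v' (T v) = c * t + (1 - c) * ip z' (T y)" .
    then show ?thesis using c z'(3) by simp
  qed
  \<comment> \<open>Write \<open>x = \<alpha> *\<^sub>R v + u\<close> with \<open>u\<close>
    \<open>A\<close>-orthogonal to \<open>v\<close> and \<open>s = nm u\<close>. Leaving the
    direction \<open>v\<close> costs \<open>S\<close> a quadratic amount in \<open>s\<close>, while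
    the correlation with \<open>T\<close> deteriorates linearly in \<open>s\<close> up to a
    quadratic term.\<close>
  have est: "(nm ((S + (- (h / t)) *\<^sub>R T) x))\<^sup>2 \<le> m" if x: "nm x = 1" for x
  proof -
    define \<alpha> where "\<alpha> = ip x v"
    define \<beta> where "\<beta> = ip x w"
    define u where "u = x - \<alpha> *\<^sub>R v"
    define s where "s = nm u"
    have s0: "0 \<le> s" by (simp add: s_def nm_nonneg)
    have s2: "s\<^sup>2 = 1 - \<alpha>\<^sup>2"
      using x vw unfolding s_def nm_sq
      by (simp add: u_def ip_commute[of v x] nm_eq_1_iff power2_eq_square algebra_simps
          flip: \<alpha>_def)
    have "\<alpha>\<^sup>2 + \<beta>\<^sup>2 \<le> 1" using Bessel[of x] x by (simp add: \<alpha>_def \<beta>_def nm_eq_1_iff)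
    then have "\<beta>\<^sup>2 \<le> s\<^sup>2" using s2 by simp
    then have \<beta>: "\<bar>\<beta>\<bar> \<le> s" using s0 by (simp add: abs_le_square_iff[symmetric])
    have \<alpha>: "\<bar>\<alpha>\<bar> \<le> 1" using s2 by (metis abs_square_le_1 diff_ge_0_iff_ge zero_le_power2)
    have v'Tu: "\<bar>ip v' (T u)\<bar> \<le> t * s"
      using Cauchy_Schwarz_ip[of v' "T u"] nm_le_A_opnorm_mult[OF T, of u]
      by (simp add: nm_v' s_def t_def)
    have Tx: "nm (T x) \<le> t" using nm_le_A_opnorm[OF T x] by (simp add: t_def)
    have w'Tx: "\<bar>ip w' (T x)\<bar> \<le> t"
      using Cauchy_Schwarz_ip[of w' "T x"] Tx by (simp add: nm_w')
    have P_eq: "ip (S x) (T x) = \<alpha>\<^sup>2 * ip v' (T v) + \<alpha> * ip v' (T u) - \<beta> / 3 * ip w' (T x)"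
      by (simp add: S u_def blinfun.bilinear_simps power2_eq_square algebra_simps
          flip: \<alpha>_def \<beta>_def)
    have "\<bar>\<alpha> * ip v' (T u)\<bar> \<le> 1 * (t * s)"
      unfolding abs_mult by (intro mult_mono \<alpha> v'Tu) auto
    moreover have "\<bar>\<beta> * ip w' (T x)\<bar> \<le> s * t"
      unfolding abs_mult by (intro mult_mono \<beta> w'Tx s0) auto
    moreover have "\<alpha>\<^sup>2 * (c * t) \<le> \<alpha>\<^sup>2 * ip v' (T v)"
      by (intro mult_left_mono vTv) simp
    \<comment> \<open>The 4/3 is 1 from the component \<open>u\<close> plus 1/3 from the second
      singular value of \<open>S\<close>.\<close>
    ultimately have P: "(c * (1 - s\<^sup>2) - 4 / 3 * s) * t \<le> ip (S x) (T x)"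
      unfolding P_eq s2 by (simp add: algebra_simps)
    have "(nm ((S + (- (h / t)) *\<^sub>R T) x))\<^sup>2
        = ip (S x) (S x) - 2 * (h / t) * ip (S x) (T x) + (h / t)\<^sup>2 * (nm (T x))\<^sup>2"
      unfolding nm_sq
      by (simp add: blinfun.bilinear_simps ip_commute[of "T x" "S x"]
          power2_eq_square algebra_simps)
    also have "\<dots> \<le> (1 - 8 / 9 * s\<^sup>2) - 2 * h * (c * (1 - s\<^sup>2) - 4 / 3 * s) + h\<^sup>2"
    proof (intro add_mono diff_mono)
      show "ip (S x) (S x) \<le> 1 - 8 / 9 * s\<^sup>2"
        using \<open>\<beta>\<^sup>2 \<le> s\<^sup>2\<close> s2 unfolding SS \<alpha>_def[symmetric] \<beta>_def[symmetric] by linarith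
      have "2 * (h / t) * ((c * (1 - s\<^sup>2) - 4 / 3 * s) * t) \<le> 2 * (h / t) * ip (S x) (T x)"
        using h t by (intro mult_left_mono P) simp
      then show "2 * h * (c * (1 - s\<^sup>2) - 4 / 3 * s) \<le> 2 * (h / t) * ip (S x) (T x)"
        using t by simp
      have "(h / t)\<^sup>2 * (nm (T x))\<^sup>2 \<le> (h / t)\<^sup>2 * t\<^sup>2"
        using Tx by (intro mult_left_mono power_mono nm_nonneg) auto
      then show "(h / t)\<^sup>2 * (nm (T x))\<^sup>2 \<le> h\<^sup>2" using t by (simp add: power_divide)
    qed
    \<comment> \<open>After \<open>h * c \<le> 1 / 9\<close> the coefficient of the squared
      \<open>s\<close> is -2/3. Completing the square adds 8/3 to the existing 1 in front of the
      squared \<open>h\<close>, whence 11/3 in \<open>m\<close>.\<close>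
    also have "\<dots> \<le> m"
    proof -
      have "h * c \<le> 1 / 9 * 1" using h c by (intro mult_mono) auto
      then have "(h * c) * s\<^sup>2 \<le> 1 / 9 * s\<^sup>2" by (intro mult_right_mono) auto
      moreover have "0 \<le> 2 / 3 * (s - 2 * h)\<^sup>2" by simp
      ultimately show ?thesis unfolding m_def power2_diff
        by (simp add: algebra_simps power_mult_distrib)
    qed
    finally show ?thesis .
  qed
  have m0: "0 \<le> m" using est[OF x0(1)] by (rule order_trans[OF zero_le_power2])
  have "A_opnorm A (S + (- (h / t)) *\<^sub>R T) \<le> sqrt m"
    using est m0 by (intro A_opnorm_least real_le_rsqrt) auto
  then have up: "(A_opnorm A (S + (- (h / t)) *\<^sub>R T))\<^sup>2 \<le> m"
    using A_opnorm_nonneg[OF A_bounded_add_scaleR[OF SA T]] m0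
    by (metis power_mono real_sqrt_pow2)
  have hT: "A_opnorm A ((- (h / t)) *\<^sub>R T) \<le> h"
  proof (rule A_opnorm_least)
    fix x assume "nm x = 1"
    then have "nm (T x) \<le> t" using nm_le_A_opnorm[OF T] by (simp add: t_def)
    then have "(h / t) * nm (T x) \<le> (h / t) * t" using h t by (intro mult_left_mono) auto
    then show "nm (((- (h / t)) *\<^sub>R T) x) \<le> h"
      using h t unfolding blinfun.scaleR_left nm_scale by simp
  qed (use h in simp)
  \<comment> \<open>The first-order gain \<open>2 * h * (c - \<epsilon>)\<close> beats the
    second-order error, so the norm of \<open>S\<close> drops by more than approximate orthogonality
    permits.\<close>
  have "m < 1 - 2 * \<epsilon> * h"
  proof -
    have "11 / 3 * h < 2 * (c - \<epsilon>)" using eps by (simp add: h_def c_def)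
    then have "h * (11 / 3 * h) < h * (2 * (c - \<epsilon>))" using h by (intro mult_strict_left_mono)
    then show ?thesis by (simp add: m_def power2_eq_square algebra_simps)
  qed
  moreover have "2 * \<epsilon> * A_opnorm A ((- (h / t)) *\<^sub>R T) \<le> 2 * \<epsilon> * h"
    using hT eps by (intro mult_left_mono) auto
  ultimately have "\<not> approx_orthogonal \<epsilon> A S T"
    unfolding approx_orthogonal_def not_all S1 using up
    by (intro exI[of _ "- (h / t)"]) simp
  then show ?thesis using orth SA unfolding approx_left_symmetric_def by blast
qed

theorem theorem3p12:
  fixes A T :: "'a::{real_inner, complete_space} \<Rightarrow>\<^sub>L 'a" and \<epsilon> :: real
  assumes infinite_dimensional: "\<nexists>B :: 'a set. finite B \<and> span B = UNIV"
    and separable: "separable_space (euclidean :: 'a topology)"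
    and positive: "positive_operator A"
    and rank_not_one: "dim (range A) \<noteq> 1"
    and bounded: "bounded (A_ball A \<inter> closure (range A))"
    and epsilon: "\<epsilon> \<in> {0..<1}"
    and A_bounded: "A_bounded A T"
    and compact: "compact_operator T"
  shows "approx_left_symmetric \<epsilon> A T \<longleftrightarrow> A_opnorm A T = 0"
proof -
  interpret positive_op A by unfold_locales (rule positive)
  show ?thesis
  proof
    assume sym: "approx_left_symmetric \<epsilon> A T"
    show "A_opnorm A T = 0"
    proof (rule ccontr)
      assume "A_opnorm A T \<noteq> 0"
      then have pos: "A_opnorm A T > 0" using A_opnorm_nonneg[OF A_bounded] by simp
      obtain x where "nm x = 1" "nm (T x) = A_opnorm A T"
        using compact_operator_attains_A_opnorm[OF positive bounded A_bounded compact pos] .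
      with norming_vector_not_left_symmetric[OF rank_not_one _ _ A_bounded pos] epsilon sym
      show False by auto
    qed
  next
    \<comment> \<open>Adding a multiple of \<open>T\<close> now leaves the \<open>A\<close>-norm of
      any \<open>S\<close> unchanged, and the term subtracted in the definition is
      nonnegative.\<close>
    assume null: "A_opnorm A T = 0"
    have "A_opnorm A (r *\<^sub>R T) \<ge> 0" for r
      by (intro A_opnorm_nonneg A_bounded_scaleR A_bounded)
    then have "approx_orthogonal \<epsilon> A S T" if "A_bounded A S" for S
      using epsilon A_opnorm_nonneg[OF that]
      by (simp add: approx_orthogonal_def A_opnorm_add_null[OF A_bounded null])
    then show "approx_left_symmetric \<epsilon> A T"
      using A_bounded by (simp add: approx_left_symmetric_def)
  qed
qed

end
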